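(* Let $q\geq 3$ be an integer, let $G\in\mathcal{A}(q)$ with maximum degree $\Delta(G)=t\geq q+2$, and let $f$ and $g$ be two different proper $t$-colorings of $G$. Suppose the subgraph $G(f,g,t)$ has a component which is a path of even length. Then there is a proper $t$-coloring $\overline f$ of $G$ such that $\overline f$ is $(q+1)$-equivalent to $f$ and $|M(\overline f,t)\cap M(g,t)|>|M(f,t)\cap M(g,t)|$.
   Context: Graphs are finite and simple. A $t$-coloring of $G$ is a map $f:E(G)\to\{1,\dots,t\}$; it is proper if adjacent edges get distinct colors. $M(f,j)$ is the set of edges of color $j$ under $f$. For an integer $q\geq 2$, $\mathcal{A}(q)$ is the set of graphs $G$ such that every subgraph $H$ of $G$ with $\Delta(H)\leq q$ has a proper $q$-edge-coloring. $G(f,g,t)$ is the subgraph of $G$ formed by the edge set $M(f,t)\triangle M(g,t)$ (symmetric difference) together with its endpoints. Two $t$-colorings differ by at most $n$ color classes if the number of colors $j$ with $M(f,j)\neq M(g,j)$ is at most $n$. Two proper $t$-colorings $f,h$ are $n$-equivalent if there is a sequence $f_0=f,f_1,\dots,f_k=h$ ($k\geq 1$) of proper $t$-colorings of $G$ with $f_i$ differing from $f_{i-1}$ by at most $n$ color classes for each $i$. *)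

theory Defs
  imports "HOL-Library.FuncSet"
begin

record 'a ugraph =
  verts :: "'a set"
  edges :: "'a set set"

definition simple_graph :: "'a ugraph \<Rightarrow> bool" where
  "simple_graph G \<longleftrightarrow> finite (verts G) \<and> (\<forall>e\<in>edges G. e \<subseteq> verts G \<and> card e = 2)"

definition subgraph :: "'a ugraph \<Rightarrow> 'a ugraph \<Rightarrow> bool" where
  "subgraph H G \<longleftrightarrow> simple_graph H \<and> verts H \<subseteq> verts G \<and> edges H \<subseteq> edges G"

definition degree :: "'a ugraph \<Rightarrow> 'a \<Rightarrow> nat" where
  "degree G v = card {e \<in> edges G. v \<in> e}"

(* Inserting 0 only matters for the graph without vertices, where Max {} would be unspecified. *)
definition max_degree :: "'a ugraph \<Rightarrow> nat" where
  "max_degree G = Max (insert 0 (degree G ` verts G))"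

definition adj_rel :: "'a ugraph \<Rightarrow> ('a \<times> 'a) set" where
  "adj_rel G = {(u, v). {u, v} \<in> edges G \<and> u \<noteq> v}"

definition connected_graph :: "'a ugraph \<Rightarrow> bool" where
  "connected_graph G \<longleftrightarrow> verts G \<noteq> {} \<and> (\<forall>u\<in>verts G. \<forall>v\<in>verts G. (u, v) \<in> (adj_rel G)\<^sup>*)"

definition component :: "'a ugraph \<Rightarrow> 'a ugraph \<Rightarrow> bool" where
  "component C G \<longleftrightarrow> subgraph C G \<and> connected_graph C \<and>
     (\<forall>K. subgraph K G \<and> connected_graph K \<and> subgraph C K \<longrightarrow> K = C)"

(* The length of a path is its number of edges. *)
definition path_graph_of_length :: "'a ugraph \<Rightarrow> nat \<Rightarrow> bool" where
  "path_graph_of_length P n \<longleftrightarrow>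
     (\<exists>xs. distinct xs \<and> length xs = n + 1 \<and> verts P = set xs \<and>
           edges P = {{xs ! i, xs ! (i + 1)} | i. i < n})"

(* Colorings are extensional functions (undefined off the edge set), so that equality of
   HOL functions is equality of colorings as maps on the edge set. *)
definition coloring :: "'a ugraph \<Rightarrow> nat \<Rightarrow> ('a set \<Rightarrow> nat) \<Rightarrow> bool" where
  "coloring G t f \<longleftrightarrow> f \<in> edges G \<rightarrow>\<^sub>E {1..t}"

definition proper_coloring :: "'a ugraph \<Rightarrow> nat \<Rightarrow> ('a set \<Rightarrow> nat) \<Rightarrow> bool" where
  "proper_coloring G t f \<longleftrightarrow> coloring G t f \<and>
     (\<forall>e\<in>edges G. \<forall>e'\<in>edges G. e \<noteq> e' \<and> e \<inter> e' \<noteq> {} \<longrightarrow> f e \<noteq> f e')"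

definition color_class :: "'a ugraph \<Rightarrow> ('a set \<Rightarrow> nat) \<Rightarrow> nat \<Rightarrow> 'a set set" where
  "color_class G f j = {e \<in> edges G. f e = j}"

definition class_A :: "nat \<Rightarrow> 'a ugraph set" where
  "class_A q = {G. simple_graph G \<and>
     (\<forall>H. subgraph H G \<and> max_degree H \<le> q \<longrightarrow> (\<exists>f. proper_coloring H q f))}"

definition diff_graph ::
    "'a ugraph \<Rightarrow> ('a set \<Rightarrow> nat) \<Rightarrow> ('a set \<Rightarrow> nat) \<Rightarrow> nat \<Rightarrow> 'a ugraph" where
  "diff_graph G f g j =
     (let D = (color_class G f j - color_class G g j) \<union> (color_class G g j - color_class G f j)
      in \<lparr>verts = \<Union>D, edges = D\<rparr>)"

definition differ_at_most ::
    "'a ugraph \<Rightarrow> nat \<Rightarrow> nat \<Rightarrow> ('a set \<Rightarrow> nat) \<Rightarrow> ('a set \<Rightarrow> nat) \<Rightarrow> bool" where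
  "differ_at_most G t n f g \<longleftrightarrow>
     card {j \<in> {1..t}. color_class G f j \<noteq> color_class G g j} \<le> n"

definition n_equivalent ::
    "'a ugraph \<Rightarrow> nat \<Rightarrow> nat \<Rightarrow> ('a set \<Rightarrow> nat) \<Rightarrow> ('a set \<Rightarrow> nat) \<Rightarrow> bool" where
  "n_equivalent G t n f h \<longleftrightarrow>
     (\<exists>k\<ge>1. \<exists>F :: nat \<Rightarrow> 'a set \<Rightarrow> nat. F 0 = f \<and> F k = h \<and>
        (\<forall>i\<le>k. proper_coloring G t (F i)) \<and>
        (\<forall>i\<in>{1..k}. differ_at_most G t n (F (i - 1)) (F i)))"

end

theory Submission
  imports Defs
begin

text \<open>
  Let M be the class of colour t under f, let e(0), e(1), ..., e(k-1) be the edges of the path that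
  have colour t under g, numbered from the end x(0) that M misses, and let m(i) be the M-edge of the
  path between e(i) and e(i+1). Flipping M along the whole path gives the desired new class, but one
  recolouring of q + 1 classes can realise it only if none of its edges lies in the
  t - q - 1 classes left fixed, which form a set D of colours. So D is first moved off the e(i)
  one at a time.

  Suppose D avoids e(0), ..., e(j-1) and those edges of M that have not been passed, and e(j) has a
  colour in D. Delete from the union of the classes outside D the edges e(0), ..., e(j-1) and M
  without m(0), ..., m(j-2). What remains has maximum degree at most q, so it has a proper
  q-colouring; since only one vertex was hit twice by the deletion, all but at most one colour class
  K of it can become a colour class of a recolouring of the classes outside D. In D, replace the
  colour of e(j) by the colour of K: the new D avoids e(0), ..., e(j). The end of the path that g
  misses in colour t must keep missing a colour outside D, which excludes at most one further choice
  of K; hence q \<ge> 3. The intermediate colourings do not preserve the class of colour t.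
\<close>

section \<open>Degrees counted by colours, and chains of recolourings\<close>

definition edges_at :: "'a set set \<Rightarrow> 'a \<Rightarrow> 'a set set" where
  "edges_at F v = {e \<in> F. v \<in> e}"

lemma finite_edges:
  assumes "simple_graph G"
  shows "finite (edges G)"
proof (rule finite_subset)
  show "edges G \<subseteq> Pow (verts G)" using assms by (auto simp: simple_graph_def)
  show "finite (Pow (verts G))" using assms by (simp add: simple_graph_def)
qed

lemma proper_coloring_unique:
  assumes "proper_coloring G t h" "e \<in> edges G" "e' \<in> edges G" "v \<in> e" "v \<in> e'" "h e = h e'"
  shows "e = e'"
  using assms unfolding proper_coloring_def by blast

lemma proper_coloring_range:
  assumes "proper_coloring G t h" "e \<in> edges G"
  shows "h e \<in> {1..t}"
  using assms unfolding proper_coloring_def coloring_def by (meson PiE_mem)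

text \<open>A proper colouring is injective on the edges at a vertex, so a degree can be bounded by
  counting the colours available there.\<close>

lemma card_edges_at_le:
  assumes "proper_coloring G t h" "finite C" "F \<subseteq> edges G" "h ` edges_at F v \<subseteq> C"
  shows "card (edges_at F v) \<le> card C"
proof (rule card_inj_on_le)
  show "inj_on h (edges_at F v)"
    using proper_coloring_unique[OF assms(1)] assms(3) by (auto simp: inj_on_def edges_at_def)
qed (use assms in auto)

text \<open>A chain needs at least one step, so a single step that changes nothing is used.\<close>

lemma n_equivalent_refl:
  assumes "proper_coloring G t f"
  shows "n_equivalent G t n f f"
  unfolding n_equivalent_def
  by (rule exI[of _ 1], simp, rule exI[of _ "\<lambda>_. f"]) (simp add: assms differ_at_most_def)

text \<open>Recolourings are produced starting from f, but the chain is read from the newest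
  colouring back to f; hence it grows at its front.\<close>

lemma n_equivalent_cons:
  assumes "proper_coloring G t h'" "differ_at_most G t n h' h" "n_equivalent G t n h f"
  shows "n_equivalent G t n h' f"
proof -
  obtain k :: nat and F where k: "k \<ge> 1" and F: "F 0 = h" "F k = f" "\<forall>i\<le>k. proper_coloring G t (F i)"
    "\<forall>i\<in>{1..k}. differ_at_most G t n (F (i - 1)) (F i)"
    using assms(3) unfolding n_equivalent_def by blast
  define F' where "F' i = (if i = 0 then h' else F (i - 1))" for i
  have "differ_at_most G t n (F' (i - 1)) (F' i)" if "i \<in> {1..Suc k}" for i
  proof (cases "i = 1")
    case True then show ?thesis using assms(2) F(1) by (simp add: F'_def)
  next
    case False
    then have "i - 1 \<in> {1..k}" using that by auto
    then have "differ_at_most G t n (F (i - 1 - 1)) (F (i - 1))" using F(4) by blast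
    then show ?thesis using \<open>i - 1 \<in> {1..k}\<close> by (auto simp: F'_def)
  qed
  moreover have "\<forall>i\<le>Suc k. proper_coloring G t (F' i)" using assms(1) F(3) by (auto simp: F'_def)
  moreover have "F' 0 = h'" "F' (Suc k) = f" using F(2) by (auto simp: F'_def)
  ultimately show ?thesis unfolding n_equivalent_def
    by (intro exI[of _ "Suc k"] conjI exI[of _ F']) auto
qed

section \<open>Recolouring q + 1 classes at once\<close>

lemma class_A_edge_subset_coloring:
  assumes "G \<in> class_A q" "F \<subseteq> edges G" "\<And>v. card (edges_at F v) \<le> q"
  obtains \<phi> where "proper_coloring \<lparr>verts = verts G, edges = F\<rparr> q \<phi>"
proof -
  let ?H = "\<lparr>verts = verts G, edges = F\<rparr>"
  have s: "simple_graph G" using assms(1) by (simp add: class_A_def)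
  then have "subgraph ?H G" using assms(2) by (auto simp: subgraph_def simple_graph_def)
  moreover have "max_degree ?H \<le> q"
    using assms(3) s unfolding max_degree_def
    by (auto simp: degree_def edges_at_def simple_graph_def)
  ultimately show thesis using assms(1) that unfolding class_A_def by blast
qed

text \<open>Once K is deleted, the classes in R form a graph of maximum degree at most q, for which
  the q colours of \<open>R - {\<kappa>}\<close> suffice. The matching K then takes \<kappa> as a
  class of its own.\<close>

lemma recolor:
  assumes A: "G \<in> class_A q" and h: "proper_coloring G t h"
    and R: "R \<subseteq> {1..t}" "card R = q + 1" "\<kappa> \<in> R"
    and K: "K \<subseteq> {e \<in> edges G. h e \<in> R}"
    and Km: "pairwise disjnt K"
    and deg: "\<And>v. card (edges_at ({e \<in> edges G. h e \<in> R} - K) v) \<le> q"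
  obtains h' where "proper_coloring G t h'" "differ_at_most G t (q + 1) h' h"
    "\<And>e. e \<in> edges G \<Longrightarrow> h e \<notin> R \<Longrightarrow> h' e = h e"
    "\<And>e. e \<in> K \<Longrightarrow> h' e = \<kappa>"
    "\<And>e. e \<in> edges G \<Longrightarrow> h e \<in> R \<Longrightarrow> e \<notin> K \<Longrightarrow> h' e \<in> R - {\<kappa>}"
proof -
  let ?F = "{e \<in> edges G. h e \<in> R} - K"
  obtain \<phi> where \<phi>: "proper_coloring \<lparr>verts = verts G, edges = ?F\<rparr> q \<phi>"
    using class_A_edge_subset_coloring[OF A _ deg] by blast
  have finR: "finite R" using R(1) finite_subset by blast
  then have "card (R - {\<kappa>}) = card {1..q}" using R by simp
  then obtain b where b: "bij_betw b {1..q} (R - {\<kappa>})"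
    using finR by (metis finite_atLeastAtMost finite_Diff finite_same_card_bij)
  have \<phi>r: "\<phi> e \<in> {1..q}" if "e \<in> ?F" for e
    using proper_coloring_range[OF \<phi>] that by simp
  define h' where "h' e = (if e \<in> K then \<kappa> else if e \<in> ?F then b (\<phi> e) else h e)" for e
  have hK: "h' e = \<kappa>" if "e \<in> K" for e using that by (simp add: h'_def)
  have hF: "h' e \<in> R - {\<kappa>}" if "e \<in> ?F" for e
    using that bij_betwE[OF b] \<phi>r[OF that] by (auto simp: h'_def)
  have hO: "h' e = h e" if "e \<in> edges G" "h e \<notin> R" for e
    using that K by (auto simp: h'_def)
  \<comment> \<open>No edge enters or leaves the union of the classes in R. So edges recoloured
    within R cannot clash with the others, and only the q + 1 classes in R can change.\<close>
  have inR: "h' e \<in> R \<longleftrightarrow> h e \<in> R" if "e \<in> edges G" for e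
  proof (cases "e \<in> K")
    case True
    then show ?thesis using hK R(3) K by auto
  next
    case False
    then show ?thesis using hF[of e] hO[of e] that by (cases "h e \<in> R") auto
  qed
  have "proper_coloring G t h'"
    unfolding proper_coloring_def coloring_def
  proof (intro conjI ballI impI PiE_I)
    fix e assume "e \<in> edges G"
    then show "h' e \<in> {1..t}"
      using inR[of e] hO[of e] R(1) proper_coloring_range[OF h] by (cases "h e \<in> R") auto
  next
    fix e assume e: "e \<notin> edges G"
    \<comment> \<open>K consists of edges of G, so off the edge set \<open>h'\<close> inherits the
      value \<open>undefined\<close> from h.\<close>
    then have "h' e = h e" using K by (auto simp: h'_def)
    then show "h' e = undefined"
      using h e unfolding proper_coloring_def coloring_def by (metis PiE_arb)
  next
    fix e e' assume e: "e \<in> edges G" "e' \<in> edges G" "e \<noteq> e' \<and> e \<inter> e' \<noteq> {}"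
    then obtain v where v: "v \<in> e" "v \<in> e'" by blast
    show "h' e \<noteq> h' e'"
    proof
      assume eq: "h' e = h' e'"
      consider "h e \<notin> R" | "e \<in> K" | "e \<in> ?F" using e(1) by blast
      then show False
      proof cases
        case 1
        then have "h e' \<notin> R" using inR[OF e(1)] inR[OF e(2)] eq by simp
        then have "h e = h e'" using 1 eq hO[OF e(1)] hO[OF e(2)] by simp
        then show False using proper_coloring_unique[OF h e(1,2) v] e(3) by blast
      next
        case 2
        then have "h e \<in> R" "h' e' = \<kappa>" using K hK eq by auto
        then have "e' \<in> K" using hF[of e'] inR[OF e(2)] R(3) e(2) by auto
        then show False using Km 2 v e(3) by (auto simp: pairwise_def disjnt_iff)
      next
        case 3
        then have "h' e' \<in> R - {\<kappa>}" using hF eq by metis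
        then have "e' \<in> ?F" using hK[of e'] inR[OF e(2)] e(2) by auto
        moreover from this 3 have "\<phi> e = \<phi> e'"
          using eq b \<phi>r by (auto simp: h'_def bij_betw_def inj_on_def)
        ultimately show False using proper_coloring_unique[OF \<phi>, of e e' v] 3 v e(3) by simp
      qed
    qed
  qed
  moreover have "differ_at_most G t (q + 1) h' h"
  proof -
    have "{j \<in> {1..t}. color_class G h' j \<noteq> color_class G h j} \<subseteq> R"
    proof (rule subsetI, rule ccontr)
      fix j assume j: "j \<in> {j \<in> {1..t}. color_class G h' j \<noteq> color_class G h j}" "j \<notin> R"
      then have "color_class G h' j = color_class G h j"
        using inR hO unfolding color_class_def by (intro Collect_cong) metis
      then show False using j by simp
    qed
    then show ?thesis unfolding differ_at_most_def using card_mono[OF finR] R(2) by metis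
  qed
  ultimately show thesis using that hK hF hO by blast
qed

section \<open>The alternating path and the edge sets derived from it\<close>

text \<open>The path is oriented to begin with an edge of colour t under g. That it is a whole
  component of the difference graph is recorded only at its two ends, by \<open>first_free\<close>
  and \<open>last_free\<close>.\<close>

locale even_alternating_path =
  fixes G :: "'a ugraph" and q t k :: nat and f g :: "'a set \<Rightarrow> nat" and xs :: "'a list"
  assumes q_ge: "q \<ge> 3" and in_A: "G \<in> class_A q" and t_ge: "t \<ge> q + 2"
    and proper_f: "proper_coloring G t f" and proper_g: "proper_coloring G t g"
    and distinct_xs: "distinct xs" and length_xs: "length xs = 2 * k + 1" and k_pos: "k > 0"
    and even_edge: "\<And>i. i < k \<Longrightarrow>
      {xs ! (2 * i), xs ! (2 * i + 1)} \<in> color_class G g t - color_class G f t"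
    and odd_edge: "\<And>i. i < k \<Longrightarrow>
      {xs ! (2 * i + 1), xs ! (2 * i + 2)} \<in> color_class G f t - color_class G g t"
    and first_free: "\<And>e. e \<in> color_class G f t \<Longrightarrow> xs ! 0 \<notin> e"
    and last_free: "\<And>e. e \<in> color_class G g t \<Longrightarrow> xs ! (2 * k) \<notin> e"
begin

abbreviation "M \<equiv> color_class G f t"

definition ev :: "nat \<Rightarrow> 'a set" where "ev i = {xs ! (2 * i), xs ! (2 * i + 1)}"
definition od :: "nat \<Rightarrow> 'a set" where "od i = {xs ! (2 * i + 1), xs ! (2 * i + 2)}"

text \<open>The edge \<open>od (j - 1)\<close> is kept in \<open>mixed j\<close>, although \<open>ev (j - 1)\<close> meets it, so that every vertex
  covered by M stays covered; the vertex \<open>xs ! (2 * j - 1)\<close> is covered twice.\<close>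

definition mixed :: "nat \<Rightarrow> 'a set set" where
  "mixed j = ev ` {..<j} \<union> (M - {od i | i. i + 1 < j})"

text \<open>This is the symmetric difference of M and the edge set of the path.\<close>

definition switched :: "'a set set" where
  "switched = ev ` {..<k} \<union> (M - od ` {..<k})"

lemma fin: "finite (edges G)"
  using in_A finite_edges by (auto simp: class_A_def)

lemma fin_at [simp]: "F \<subseteq> edges G \<Longrightarrow> finite (edges_at F v)"
  using fin by (auto simp: edges_at_def intro: finite_subset)

lemma nth_inj: "i \<le> 2 * k \<Longrightarrow> j \<le> 2 * k \<Longrightarrow> xs ! i = xs ! j \<longleftrightarrow> i = j"
  using distinct_xs length_xs by (simp add: nth_eq_iff_index_eq)

lemma ev_in: "i < k \<Longrightarrow> ev i \<in> edges G" "i < k \<Longrightarrow> g (ev i) = t" "i < k \<Longrightarrow> ev i \<notin> M"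
  using even_edge[of i] by (auto simp: ev_def color_class_def)

lemma od_in: "i < k \<Longrightarrow> od i \<in> M" "i < k \<Longrightarrow> od i \<in> edges G"
  using odd_edge[of i] by (auto simp: od_def color_class_def)

lemma M_unique: "e \<in> M \<Longrightarrow> e' \<in> M \<Longrightarrow> v \<in> e \<Longrightarrow> v \<in> e' \<Longrightarrow> e = e'"
  using proper_coloring_unique[OF proper_f] by (auto simp: color_class_def)

lemma ev_unique: "i < k \<Longrightarrow> i' < k \<Longrightarrow> v \<in> ev i \<Longrightarrow> v \<in> ev i' \<Longrightarrow> ev i = ev i'"
  using proper_coloring_unique[OF proper_g] ev_in by metis

lemma mixed_sub: "j \<le> k \<Longrightarrow> mixed j \<subseteq> edges G"
  using ev_in by (auto simp: mixed_def color_class_def)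

lemma switched_sub: "switched \<subseteq> edges G"
  using ev_in by (auto simp: switched_def color_class_def)

text \<open>M is a matching, and each end of \<open>ev i\<close> other than \<open>xs ! 0\<close> is
  already covered by the neighbouring M-edge of the path; M misses \<open>xs ! 0\<close>.\<close>

lemma ev_meets_M:
  assumes "i < k" "v \<in> ev i" "e \<in> M" "v \<in> e"
  shows "(v = xs ! (2 * i) \<and> i > 0 \<and> e = od (i - 1)) \<or> (v = xs ! (2 * i + 1) \<and> e = od i)"
proof -
  consider "v = xs ! (2 * i)" | "v = xs ! (2 * i + 1)" using assms(2) by (auto simp: ev_def)
  then show ?thesis
  proof cases
    case 1
    then have "i > 0" using first_free assms(3,4) by (cases i) auto
    moreover from this have "v \<in> od (i - 1)" using 1 by (cases i) (auto simp: od_def)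
    moreover have "od (i - 1) \<in> M" using od_in assms(1) by simp
    ultimately show ?thesis using 1 M_unique assms(3,4) by blast
  next
    case 2
    then have "v \<in> od i" by (auto simp: od_def)
    then show ?thesis using 2 M_unique assms od_in(1) by blast
  qed
qed

lemma ev_covered:
  assumes "i < k" "v \<in> ev i" "v \<noteq> xs ! 0"
  shows "\<exists>e\<in>M. v \<in> e"
proof -
  consider "v = xs ! (2 * i)" | "v = xs ! (2 * i + 1)" using assms(2) by (auto simp: ev_def)
  then show ?thesis
  proof cases
    case 1
    then have "i > 0" using assms(3) by (cases i) auto
    then have "v \<in> od (i - 1)" "od (i - 1) \<in> M" using 1 od_in assms(1) by (cases i, auto simp: od_def)
    then show ?thesis by blast
  next
    case 2
    then have "v \<in> od i" by (auto simp: od_def)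
    then show ?thesis using od_in(1) assms(1) by blast
  qed
qed

text \<open>An M-edge that meets \<open>ev i\<close> is \<open>od (i - 1)\<close> or
  \<open>od i\<close>. For i < j these have been deleted, except \<open>od (j - 1)\<close>, which
  meets \<open>ev (j - 1)\<close> in the excluded vertex only. For j = 0 truncated subtraction makes
  that vertex \<open>xs ! 0\<close>.\<close>

lemma mixed_unique:
  assumes "j \<le> k" "v \<noteq> xs ! (2 * j - 1)" "e \<in> mixed j" "e' \<in> mixed j" "v \<in> e" "v \<in> e'"
  shows "e = e'"
proof -
  have no: False if "i < j" "v \<in> ev i" "d \<in> M" "d \<notin> {od i | i. i + 1 < j}" "v \<in> d" for i d
  proof -
    have "i < k" using that assms(1) by simp
    from ev_meets_M[OF this that(2,3,5)] show False
    proof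
      assume "v = xs ! (2 * i) \<and> i > 0 \<and> d = od (i - 1)"
      then show False using that(1,4) by auto
    next
      assume a: "v = xs ! (2 * i + 1) \<and> d = od i"
      then have "\<not> i + 1 < j" using that(4) by auto
      then have "j = Suc i" using that(1) by simp
      then show False using a assms(2) by simp
    qed
  qed
  have ee: "ev i = ev i'" if "i < j" "i' < j" "v \<in> ev i" "v \<in> ev i'" for i i'
    using ev_unique[of i i' v] that assms(1) by simp
  show ?thesis using assms(3-6) no ee M_unique[of e e' v] unfolding mixed_def by blast
qed

lemma card_mixed_at:
  assumes "j \<le> k" "v \<noteq> xs ! (2 * j - 1)"
  shows "card (edges_at (mixed j) v) \<le> 1"
  using mixed_unique[OF assms] mixed_sub[OF assms(1)] fin_at[of "mixed j" v]
  by (auto simp: card_le_Suc0_iff_eq edges_at_def)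

text \<open>The edges come from two matchings: M and the colour class of t under g.\<close>

lemma card_mixed_at2:
  assumes "j \<le> k"
  shows "card (edges_at (mixed j) v) \<le> 2"
proof -
  have a: "card (edges_at M v) \<le> 1"
    using M_unique fin_at[of M v] by (auto simp: card_le_Suc0_iff_eq edges_at_def color_class_def)
  have s: "ev ` {..<j} \<subseteq> edges G" using ev_in assms by auto
  have "e = e'" if "e \<in> edges_at (ev ` {..<j}) v" "e' \<in> edges_at (ev ` {..<j}) v" for e e'
  proof -
    obtain i i' where "i < j" "i' < j" "e = ev i" "e' = ev i'" "v \<in> ev i" "v \<in> ev i'"
      using \<open>e \<in> _\<close> \<open>e' \<in> _\<close> by (auto simp: edges_at_def)
    then show ?thesis using ev_unique[of i i' v] assms by simp
  qed
  then have b: "card (edges_at (ev ` {..<j}) v) \<le> 1"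
    using fin_at[OF s, of v] by (simp add: card_le_Suc0_iff_eq)
  have "card (edges_at (mixed j) v) \<le> card (edges_at (ev ` {..<j}) v \<union> edges_at M v)"
    using s by (intro card_mono) (auto simp: mixed_def edges_at_def fin color_class_def intro: finite_subset[OF _ fin])
  also have "\<dots> \<le> 2" using card_Un_le[of "edges_at (ev ` {..<j}) v" "edges_at M v"] a b by linarith
  finally show ?thesis .
qed

text \<open>A deleted edge \<open>od i\<close> has its ends on \<open>ev i\<close> and
  \<open>ev (i + 1)\<close>, and i + 1 < j puts both of these into \<open>mixed j\<close>.\<close>

lemma mixed_uncovered:
  assumes "j \<le> k" "\<And>e. e \<in> mixed j \<Longrightarrow> v \<notin> e" "e \<in> M"
  shows "v \<notin> e"
proof
  assume v: "v \<in> e"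
  then have "e \<notin> mixed j" using assms(2) by blast
  then obtain i where i: "e = od i" "i + 1 < j" using assms(3) by (auto simp: mixed_def)
  then have "v \<in> ev i \<or> v \<in> ev (i + 1)" using v by (auto simp: od_def ev_def)
  then show False using assms(2)[of "ev i"] assms(2)[of "ev (i + 1)"] i by (auto simp: mixed_def)
qed

text \<open>This carries the degree bound at missed vertices from one stage to the next. A vertex
  covered by \<open>mixed j\<close> is \<open>xs ! 0\<close>, which lies on \<open>ev 0\<close>, or
  is covered by M and therefore by \<open>mixed (Suc j)\<close>.\<close>

lemma mixed_uncovered_Suc:
  assumes "Suc j \<le> k" "\<And>e. e \<in> mixed (Suc j) \<Longrightarrow> v \<notin> e" "e \<in> mixed j"
  shows "v \<notin> e"
proof
  assume v: "v \<in> e"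
  have "ev 0 \<in> mixed (Suc j)" by (auto simp: mixed_def)
  then have v0: "v \<noteq> xs ! 0" using assms(2) by (auto simp: ev_def)
  consider i where "i < j" "e = ev i" | "e \<in> M" using assms(3) by (auto simp: mixed_def)
  then have "\<exists>d\<in>M. v \<in> d"
  proof cases
    case 1
    then show ?thesis using ev_covered[of i v] v v0 assms(1) by simp
  qed (use v in blast)
  then show False using mixed_uncovered[OF assms(1,2)] by blast
qed

lemma mixed_0: "mixed 0 = M" by (auto simp: mixed_def)

lemma mixed_Suc: "mixed (Suc j) \<subseteq> insert (ev j) (mixed j)"
proof
  fix e assume "e \<in> mixed (Suc j)"
  then show "e \<in> insert (ev j) (mixed j)"
    unfolding mixed_def by (auto simp del: insert_iff simp: lessThan_Suc)
qed

section \<open>Moving D off the path, one edge at a time\<close>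

text \<open>The degree bound says that each vertex
  missed by \<open>mixed j\<close>, and the last vertex of the path, misses one of the q + 1 colours outside D.\<close>

definition stage :: "nat \<Rightarrow> ('a set \<Rightarrow> nat) \<Rightarrow> nat set \<Rightarrow> bool" where
  "stage j h D \<longleftrightarrow> proper_coloring G t h \<and> n_equivalent G t (q + 1) h f \<and>
     D \<subseteq> {1..<t} \<and> card D = t - q - 1 \<and> (\<forall>e\<in>mixed j. h e \<notin> D) \<and>
     (\<forall>v. (\<forall>e\<in>mixed j. v \<notin> e) \<or> v = xs ! (2 * k) \<longrightarrow>
       card (edges_at {e \<in> edges G. h e \<notin> D} v) \<le> q)"

lemma complement_colors:
  assumes "D \<subseteq> {1..<t}" "card D = t - q - 1"
  shows "card ({1..t} - D) = q + 1" "t \<in> {1..t} - D"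
proof -
  have "D \<subseteq> {1..t}" using assms(1) by auto
  then have "card ({1..t} - D) = t - (t - q - 1)" using assms
    by (subst card_Diff_subset) (auto intro: finite_subset)
  then show "card ({1..t} - D) = q + 1" using t_ge by simp
  show "t \<in> {1..t} - D" using assms(1) t_ge by auto
qed

lemma uncolored_by:
  assumes "proper_coloring G t h"
  shows "{e \<in> edges G. h e \<notin> D} = {e \<in> edges G. h e \<in> {1..t} - D}"
  using proper_coloring_range[OF assms] by auto

lemma card_rest_at:
  assumes "proper_coloring G t h" "D \<subseteq> {1..<t}" "card D = t - q - 1"
  shows "card (edges_at {e \<in> edges G. h e \<notin> D} v) \<le> q + 1"
  using card_edges_at_le[OF assms(1), of "{1..t} - D" "{e \<in> edges G. h e \<notin> D}" v]
    complement_colors[OF assms(2,3)] proper_coloring_range[OF assms(1)]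
  by (auto simp: edges_at_def image_subset_iff)

lemma edges_at_Diff: "edges_at (A - B) v = edges_at A v - edges_at B v"
  by (auto simp: edges_at_def)

text \<open>Vertices missed by M miss the colour t, which is outside D. The last vertex of the path
  misses t under g, so its degree is at most t - 1 and f misses some colour s there; D is chosen to
  leave out s as well.\<close>

lemma stage_init:
  obtains D where "stage 0 f D"
proof -
  let ?z = "xs ! (2 * k)"
  have "card (edges_at (edges G) ?z) \<le> card {1..<t}"
  proof (rule card_edges_at_le[OF proper_g])
    show "g ` edges_at (edges G) ?z \<subseteq> {1..<t}"
      using proper_coloring_range[OF proper_g] last_free
      by (fastforce simp: edges_at_def color_class_def)
  qed auto
  then have "card (f ` edges_at (edges G) ?z) < card {1..t}"
    using card_image_le[OF fin_at[OF order_refl, of ?z], of f] t_ge by simp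
  then have "\<not> {1..t} \<subseteq> f ` edges_at (edges G) ?z"
    using card_mono[OF finite_imageI[OF fin_at[OF order_refl, of ?z]], of "{1..t}" f] by linarith
  then obtain s where s: "s \<in> {1..t}" "s \<notin> f ` edges_at (edges G) ?z" by blast
  have "card ({1..<t} - {s}) \<ge> t - q - 1"
    using q_ge t_ge by (simp add: card_Diff_singleton_if) linarith
  then obtain D where D: "D \<subseteq> {1..<t} - {s}" "card D = t - q - 1"
    by (meson obtain_subset_with_card_n)
  then have D1: "D \<subseteq> {1..<t}" by blast
  note cc = complement_colors[OF D1 D(2)]
  have miss: "card (edges_at {e \<in> edges G. f e \<notin> D} v) \<le> q"
    if c: "c \<in> {1..t} - D" "\<And>e. e \<in> edges G \<Longrightarrow> v \<in> e \<Longrightarrow> f e \<noteq> c" for v c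
  proof -
    have "card (edges_at {e \<in> edges G. f e \<notin> D} v) \<le> card (({1..t} - D) - {c})"
      using c proper_coloring_range[OF proper_f]
      by (intro card_edges_at_le[OF proper_f]) (auto simp: edges_at_def)
    then show ?thesis using cc(1) c(1) by simp
  qed
  have "stage 0 f D"
    unfolding stage_def mixed_0
  proof (intro conjI allI impI ballI)
    show "f e \<notin> D" if "e \<in> M" for e using that D1 by (auto simp: color_class_def)
    fix v assume v: "(\<forall>e\<in>M. v \<notin> e) \<or> v = ?z"
    then show "card (edges_at {e \<in> edges G. f e \<notin> D} v) \<le> q"
    proof
      assume "\<forall>e\<in>M. v \<notin> e"
      then show ?thesis using miss[OF cc(2)] by (auto simp: color_class_def)
    next
      assume "v = ?z"
      then show ?thesis using miss[of s v] s D(1) by (auto simp: edges_at_def)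
    qed
  qed (use proper_f n_equivalent_refl D1 D(2) in auto)
  then show thesis using that by blast
qed

lemma stage_step:
  assumes stage: "stage j h D" and j: "j < k"
  obtains h' D' where "stage (Suc j) h' D'"
proof (cases "h (ev j) \<in> D")
  \<comment> \<open>The only new edge to keep out of D is \<open>ev j\<close>, and no further vertex
    becomes uncovered, so h and D serve again.\<close>
  case False
  have "\<forall>e\<in>mixed (Suc j). h e \<notin> D"
    using stage False mixed_Suc[of j] unfolding stage_def by blast
  moreover have "card (edges_at {e \<in> edges G. h e \<notin> D} v) \<le> q"
    if v: "(\<forall>e\<in>mixed (Suc j). v \<notin> e) \<or> v = xs ! (2 * k)" for v
  proof -
    have "(\<forall>e\<in>mixed j. v \<notin> e) \<or> v = xs ! (2 * k)"
      using v mixed_uncovered_Suc[OF Suc_leI[OF j], of v] by blast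
    then show ?thesis using stage unfolding stage_def by (elim conjE) (drule spec[of _ v], erule mp)
  qed
  ultimately have "stage (Suc j) h D" using stage unfolding stage_def by simp
  then show thesis using that by blast
next
  case True
  let ?z = "xs ! (2 * k)" and ?w = "xs ! (2 * j - 1)" and ?Y = "mixed j"
  define E where "E = {e \<in> edges G. h e \<notin> D}"
  define R where "R = {1..t} - D"
  have h: "proper_coloring G t h" and eqv: "n_equivalent G t (q + 1) h f"
    and D: "D \<subseteq> {1..<t}" "card D = t - q - 1" and YD: "\<And>e. e \<in> ?Y \<Longrightarrow> h e \<notin> D"
    and low: "\<And>v. (\<forall>e\<in>?Y. v \<notin> e) \<or> v = ?z \<Longrightarrow> card (edges_at E v) \<le> q"
    using stage unfolding stage_def E_def by auto
  note cc = complement_colors[OF D, folded R_def]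
  have ER: "E = {e \<in> edges G. h e \<in> R}" unfolding E_def R_def by (rule uncolored_by[OF h])
  have Esub: "E \<subseteq> edges G" by (auto simp: E_def)
  have YE: "?Y \<subseteq> E" using YD mixed_sub[of j] j by (auto simp: E_def)
  have Edeg: "card (edges_at E v) \<le> q + 1" for v
    unfolding E_def by (rule card_rest_at[OF h D])
  have Hcard: "card (edges_at (E - ?Y) v) = card (edges_at E v) - card (edges_at ?Y v)" for v
    unfolding edges_at_Diff using YE Esub
    by (intro card_Diff_subset fin_at) (auto simp: edges_at_def)
  \<comment> \<open>A vertex covered by \<open>?Y\<close> loses an edge from at most q + 1; at any
    other vertex \<open>low\<close> gives the bound directly.\<close>
  have Hdeg: "card (edges_at (E - ?Y) v) \<le> q" for v
  proof (cases "\<exists>e\<in>?Y. v \<in> e")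
    case True
    then have "card (edges_at ?Y v) \<noteq> 0" using YE Esub fin_at[of ?Y v] by (auto simp: edges_at_def)
    then show ?thesis using Hcard[of v] Edeg[of v] by linarith
  next
    case False
    then show ?thesis using Hcard[of v] low[of v] by auto
  qed
  obtain \<phi> where \<phi>: "proper_coloring \<lparr>verts = verts G, edges = E - ?Y\<rparr> q \<phi>"
    using class_A_edge_subset_coloring[OF in_A _ Hdeg] Esub by blast
  define missing where "missing v = {1..q} - \<phi> ` edges_at (E - ?Y) v" for v
  have "inj_on \<phi> (edges_at (E - ?Y) v)" for v
    using proper_coloring_unique[OF \<phi>, of _ _ v] by (simp add: inj_on_def edges_at_def)
  then have img: "card (\<phi> ` edges_at (E - ?Y) v) = card (edges_at (E - ?Y) v)"
    "\<phi> ` edges_at (E - ?Y) v \<subseteq> {1..q}" for v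
    using proper_coloring_range[OF \<phi>] by (auto simp: card_image edges_at_def)
  have missing: "card (missing v) = q - card (edges_at (E - ?Y) v)" for v
    unfolding missing_def using img[of v] by (subst card_Diff_subset) (auto intro: finite_subset)
  \<comment> \<open>\<open>B v\<close> holds the colours to be avoided on account of v. With at
    least q - 1 edges at v, \<phi> misses at most one colour there; with fewer, the degree bounds
    hold whichever class is taken as \<open>K\<close>.\<close>
  define B where "B v = (if card (edges_at (E - ?Y) v) \<ge> q - 1 then missing v else {})" for v
  have B: "card (B v) \<le> 1" for v using missing[of v] q_ge by (auto simp: B_def)
  \<comment> \<open>Two vertices exclude at most two colours, and q is at least 3.\<close>
  have "card (B ?w \<union> B ?z) < card {1..q}"
    using card_Un_le[of "B ?w" "B ?z"] B[of ?w] B[of ?z] q_ge by simp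
  then have "\<not> {1..q} \<subseteq> B ?w \<union> B ?z"
    using card_mono[of "B ?w \<union> B ?z" "{1..q}"] by (auto simp: B_def missing_def)
  then obtain c where c: "c \<in> {1..q}" "c \<notin> B ?w" "c \<notin> B ?z" by blast
  define K where "K = {e \<in> E - ?Y. \<phi> e = c}"
  have KE: "K \<subseteq> E" by (auto simp: K_def)
  have Km: "pairwise disjnt K"
    using proper_coloring_unique[OF \<phi>] unfolding pairwise_def disjnt_iff K_def by auto
  have hit: "edges_at K v \<noteq> {}" if "c \<notin> missing v" for v
    using that c(1) by (auto simp: missing_def K_def edges_at_def)
  have full: "edges_at K v \<noteq> {}" if "card (edges_at (E - ?Y) v) \<ge> q" for v
  proof -
    have "card (missing v) = 0" using missing[of v] that by simp
    then have "missing v = {}" by (simp add: missing_def)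
    then show ?thesis using hit by simp
  qed
  have almost: "edges_at K v \<noteq> {}" if "v = ?w \<or> v = ?z" "card (edges_at (E - ?Y) v) \<ge> q - 1" for v
    using that c hit by (auto simp: B_def)
  have Kcard: "card (edges_at (E - K) v) = card (edges_at E v) - card (edges_at K v)" for v
    unfolding edges_at_Diff using KE Esub
    by (intro card_Diff_subset fin_at) (auto simp: edges_at_def)
  have drop: "card (edges_at (E - K) v) < card (edges_at E v)" if "edges_at K v \<noteq> {}" for v
  proof -
    have "edges_at K v \<subseteq> edges_at E v" using KE by (auto simp: edges_at_def)
    moreover have "finite (edges_at E v)" using Esub by simp
    ultimately have "card (edges_at K v) > 0" "card (edges_at K v) \<le> card (edges_at E v)"
      using that by (auto simp: card_gt_0_iff card_mono intro: finite_subset)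
    then show ?thesis using Kcard[of v] by linarith
  qed
  \<comment> \<open>Only a vertex of degree q + 1 in \<open>E\<close> must be hit by
    \<open>K\<close>. Away from \<open>?w\<close>, deleting \<open>?Y\<close> costs it at most one
    edge, so all q colours of \<phi> occur there. At \<open>?w\<close> it costs at most two, and
    then the choice of c ensures that c occurs.\<close>
  have Kdeg: "card (edges_at (E - K) v) \<le> q" for v
  proof (cases "card (edges_at E v) = q + 1")
    case False
    then show ?thesis using Kcard[of v] Edeg[of v] by linarith
  next
    case True
    have "edges_at K v \<noteq> {}"
    proof (cases "v = ?w")
      case True
      have "card (edges_at (E - ?Y) v) \<ge> q - 1"
        using Hcard[of v] \<open>card (edges_at E v) = q + 1\<close> card_mixed_at2[of j v] j by linarith
      then show ?thesis using almost True by blast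
    next
      case False
      have "card (edges_at (E - ?Y) v) \<ge> q"
        using Hcard[of v] \<open>card (edges_at E v) = q + 1\<close> card_mixed_at[of j v] j False by linarith
      then show ?thesis using full by blast
    qed
    then show ?thesis using drop True by fastforce
  qed
  \<comment> \<open>The colour \<kappa> is going to enter \<open>D'\<close>, which must not contain
    t.\<close>
  have "R - {t} \<noteq> {}"
  proof
    assume "R - {t} = {}"
    then have "R \<subseteq> {t}" by blast
    then have "card R \<le> 1" using card_mono[of "{t}" R] by simp
    then show False using cc(1) q_ge by simp
  qed
  then obtain \<kappa> where \<kappa>: "\<kappa> \<in> R" "\<kappa> \<noteq> t" by blast
  obtain h' where h': "proper_coloring G t h'" "differ_at_most G t (q + 1) h' h"
    "\<And>e. e \<in> edges G \<Longrightarrow> h e \<notin> R \<Longrightarrow> h' e = h e"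
    "\<And>e. e \<in> K \<Longrightarrow> h' e = \<kappa>"
    "\<And>e. e \<in> edges G \<Longrightarrow> h e \<in> R \<Longrightarrow> e \<notin> K \<Longrightarrow> h' e \<in> R - {\<kappa>}"
    using recolor[OF in_A h _ cc(1) \<kappa>(1) KE[unfolded ER] Km Kdeg[unfolded ER]]
    unfolding R_def by blast
  \<comment> \<open>The edge \<open>ev j\<close> keeps its colour, which \<open>D'\<close> gives up.
    Edges of \<open>?Y\<close> lie in \<open>E - K\<close>, so their new colours avoid both D and
    \<kappa>.\<close>
  define D' where "D' = insert \<kappa> (D - {h (ev j)})"
  have \<kappa>D: "\<kappa> \<notin> D" using \<kappa> by (auto simp: R_def)
  have finD: "finite D" using D(1) finite_subset by blast
  have "card D' = card D"
    unfolding D'_def using \<kappa>D finD True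
    by (metis Diff_iff card_Suc_Diff1 card_insert_disjoint finite_Diff)
  moreover have "D' \<subseteq> {1..<t}" using D(1) \<kappa> by (auto simp: D'_def R_def)
  moreover have "h' e \<notin> D'" if "e \<in> mixed (Suc j)" for e
  proof (cases "e = ev j")
    case True
    have "h (ev j) \<notin> R" using \<open>h (ev j) \<in> D\<close> by (simp add: R_def)
    then have "h' e = h (ev j)" using h'(3) True ev_in j by simp
    then show ?thesis using \<kappa>D \<open>h (ev j) \<in> D\<close> by (auto simp: D'_def)
  next
    case False
    then have "e \<in> ?Y" using that mixed_Suc by blast
    then have "e \<in> E" "e \<notin> K" using YE by (auto simp: K_def)
    then have "h' e \<in> R - {\<kappa>}" using h'(5) by (auto simp: ER)
    then show ?thesis by (auto simp: D'_def R_def)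
  qed
  moreover have "card (edges_at {e \<in> edges G. h' e \<notin> D'} v) \<le> q"
    if v: "(\<forall>e\<in>mixed (Suc j). v \<notin> e) \<or> v = ?z" for v
  proof -
    \<comment> \<open>An edge with colour outside \<open>D'\<close> lies in \<open>E - K\<close> or
      has the colour of \<open>ev j\<close>. That colour contributes at most one edge at v, so q - 1
      is the bound to aim for.\<close>
    have "card (edges_at (E - K) v) \<le> q - 1"
      using v
    proof
      assume "\<forall>e\<in>mixed (Suc j). v \<notin> e"
      then have nY: "\<forall>e\<in>?Y. v \<notin> e" using mixed_uncovered_Suc[of j v] j by fastforce
      then have "edges_at ?Y v = {}" by (auto simp: edges_at_def)
      then have eq: "card (edges_at (E - ?Y) v) = card (edges_at E v)" using Hcard[of v] by simp
      show ?thesis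
      proof (cases "card (edges_at E v) \<ge> q")
        case True
        then show ?thesis using full[of v] drop[of v] low[of v] eq nY by fastforce
      next
        case False
        then show ?thesis using Kcard[of v] by linarith
      qed
    next
      assume vz: "v = ?z"
      show ?thesis
      proof (cases "card (edges_at (E - ?Y) v) \<ge> q - 1")
        case True
        then show ?thesis using almost[of v] drop[of v] low[of v] vz by fastforce
      next
        case False
        \<comment> \<open>Since \<open>?Y\<close> has at most one edge at \<open>?z\<close>, fewer
          than q - 1 edges left after its deletion mean at most q - 1 edges in
          \<open>E\<close>.\<close>
        have "?z \<noteq> ?w" using nth_inj[of "2 * k" "2 * j - 1"] j by auto
        then have "card (edges_at ?Y v) \<le> 1" using card_mixed_at[of j v] j vz by simp
        then show ?thesis using False Hcard[of v] Kcard[of v] by linarith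
      qed
    qed
    moreover have "card (edges_at {e \<in> edges G. h' e = h (ev j)} v) \<le> card {h (ev j)}"
      by (rule card_edges_at_le[OF h'(1)]) (auto simp: edges_at_def)
    moreover have "card (edges_at {e \<in> edges G. h' e \<notin> D'} v)
        \<le> card (edges_at (E - K) v \<union> edges_at {e \<in> edges G. h' e = h (ev j)} v)"
    proof (rule card_mono)
      show "finite (edges_at (E - K) v \<union> edges_at {e \<in> edges G. h' e = h (ev j)} v)"
        using Esub by (intro finite_UnI fin_at) auto
      have "e \<in> E - K \<or> h' e = h (ev j)" if "e \<in> edges G" "h' e \<notin> D'" for e
        using that h'(3,4) \<kappa> by (cases "h e \<in> D") (auto simp: D'_def E_def R_def)
      then show "edges_at {e \<in> edges G. h' e \<notin> D'} v
          \<subseteq> edges_at (E - K) v \<union> edges_at {e \<in> edges G. h' e = h (ev j)} v"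
        by (auto simp: edges_at_def)
    qed
    ultimately show ?thesis
      using card_Un_le[of "edges_at (E - K) v" "edges_at {e \<in> edges G. h' e = h (ev j)} v"] q_ge
      by simp
  qed
  ultimately have "stage (Suc j) h' D'"
    unfolding stage_def using h'(1) n_equivalent_cons[OF h'(1,2) eqv] D(2) by simp
  then show thesis using that by blast
qed

lemma stage_exists:
  assumes "j \<le> k"
  shows "\<exists>h D. stage j h D"
  using assms
proof (induction j)
  case 0 then show ?case using stage_init by blast
next
  case (Suc j)
  then obtain h D where "stage j h D" by auto
  then show ?case using stage_step Suc.prems by (metis Suc_le_lessD)
qed

section \<open>Flipping the class of colour t along the whole path\<close>

lemma switched_matching: "pairwise disjnt switched"
proof -
  have no: False if "i < k" "v \<in> ev i" "d \<in> M" "d \<notin> od ` {..<k}" "v \<in> d" for i d v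
    using ev_meets_M[OF that(1,2,3,5)] that(1,4) by auto
  have "e = e'" if "e \<in> switched" "e' \<in> switched" "v \<in> e" "v \<in> e'" for e e' v
    using that no ev_unique[of _ _ v] M_unique[of e e' v] unfolding switched_def by blast
  then show ?thesis unfolding pairwise_def disjnt_iff by blast
qed

text \<open>Passing from \<open>mixed k\<close> to \<open>switched\<close> loses only
  \<open>od (k - 1)\<close>. One end of it stays covered by \<open>ev (k - 1)\<close>; the other is
  the last vertex of the path.\<close>

lemma switched_uncovered:
  assumes "\<And>e. e \<in> switched \<Longrightarrow> v \<notin> e" "v \<noteq> xs ! (2 * k)" "e \<in> mixed k"
  shows "v \<notin> e"
proof
  assume v: "v \<in> e"
  then have "e \<notin> switched" using assms(1) by blast
  then obtain i where i: "e = od i" "i < k" "i + 1 \<ge> k"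
    using assms(3) unfolding mixed_def switched_def by fastforce
  then have "k = i + 1" by simp
  then have "v \<in> ev i" using v assms(2) i(1) by (auto simp: od_def ev_def)
  then show False using assms(1)[of "ev i"] i by (auto simp: switched_def)
qed

lemma switched_sub_mixed: "switched \<subseteq> mixed k"
  by (auto simp: switched_def mixed_def)

text \<open>At stage k every edge of \<open>switched\<close> has a colour outside D, so one
  recolouring can make it the class of colour t. A vertex missed by \<open>switched\<close> is
  missed by \<open>mixed k\<close> or is the last vertex; for both the stage supplies the degree
  bound q.\<close>

lemma conclusion:
  obtains f' where "proper_coloring G t f'" "n_equivalent G t (q + 1) f' f"
    "color_class G f' t = switched"
proof -
  obtain h D where stage: "stage k h D" using stage_exists by blast
  define E where "E = {e \<in> edges G. h e \<notin> D}"
  have h: "proper_coloring G t h" and eqv: "n_equivalent G t (q + 1) h f"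
    and D: "D \<subseteq> {1..<t}" "card D = t - q - 1" and YD: "\<And>e. e \<in> mixed k \<Longrightarrow> h e \<notin> D"
    and low: "\<And>v. (\<forall>e\<in>mixed k. v \<notin> e) \<or> v = xs ! (2 * k) \<Longrightarrow> card (edges_at E v) \<le> q"
    using stage unfolding stage_def E_def by auto
  note cc = complement_colors[OF D]
  have ER: "E = {e \<in> edges G. h e \<in> {1..t} - D}" unfolding E_def by (rule uncolored_by[OF h])
  have Esub: "E \<subseteq> edges G" by (auto simp: E_def)
  have SE: "switched \<subseteq> E" using YD switched_sub switched_sub_mixed by (auto simp: E_def)
  have deg: "card (edges_at (E - switched) v) \<le> q" for v
  proof (cases "\<exists>e\<in>switched. v \<in> e")
    case True
    then have "edges_at switched v \<noteq> {}" by (auto simp: edges_at_def)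
    moreover have "edges_at switched v \<subseteq> edges_at E v" using SE by (auto simp: edges_at_def)
    ultimately have "edges_at (E - switched) v \<subset> edges_at E v" unfolding edges_at_Diff by blast
    then have "card (edges_at (E - switched) v) < card (edges_at E v)"
      using Esub by (intro psubset_card_mono) auto
    then show ?thesis using card_rest_at[OF h D, of v] by (simp add: E_def)
  next
    case False
    then have "card (edges_at E v) \<le> q" using low[of v] switched_uncovered[of v] by blast
    moreover have "card (edges_at (E - switched) v) \<le> card (edges_at E v)"
      using Esub by (intro card_mono) (auto simp: edges_at_Diff)
    ultimately show ?thesis by simp
  qed
  obtain h' where h': "proper_coloring G t h'" "differ_at_most G t (q + 1) h' h"
    "\<And>e. e \<in> edges G \<Longrightarrow> h e \<notin> {1..t} - D \<Longrightarrow> h' e = h e"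
    "\<And>e. e \<in> switched \<Longrightarrow> h' e = t"
    "\<And>e. e \<in> edges G \<Longrightarrow> h e \<in> {1..t} - D \<Longrightarrow> e \<notin> switched \<Longrightarrow> h' e \<in> ({1..t} - D) - {t}"
    using recolor[OF in_A h _ cc SE[unfolded ER] switched_matching deg[unfolded ER]] by blast
  have "color_class G h' t = switched"
  proof (intro equalityI subsetI)
    fix e assume "e \<in> switched"
    then show "e \<in> color_class G h' t" using h'(4) switched_sub by (auto simp: color_class_def)
  next
    fix e assume "e \<in> color_class G h' t"
    then have e: "e \<in> edges G" "h' e = t" by (auto simp: color_class_def)
    show "e \<in> switched"
      using h'(3)[of e] h'(5)[of e] e cc(2) by (metis Diff_iff insertI1)
  qed
  then show thesis using that h'(1) n_equivalent_cons[OF h'(1,2) eqv] by blast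
qed

text \<open>The edges removed from M do not have colour t under g, and \<open>ev 0\<close> is
  gained.\<close>

lemma switched_gain:
  "card (switched \<inter> color_class G g t) > card (M \<inter> color_class G g t)"
proof (rule psubset_card_mono)
  show "finite (switched \<inter> color_class G g t)"
    using switched_sub fin by (auto intro: finite_subset)
  have "ev 0 \<in> switched \<inter> color_class G g t" "ev 0 \<notin> M"
    using k_pos ev_in[of 0] by (auto simp: switched_def color_class_def)
  moreover have "od i \<notin> color_class G g t" if "i < k" for i
    using odd_edge[OF that] by (simp add: od_def)
  then have "M \<inter> color_class G g t \<subseteq> switched \<inter> color_class G g t"
    by (auto simp: switched_def)
  ultimately show "M \<inter> color_class G g t \<subset> switched \<inter> color_class G g t" by blast
qed

end

section \<open>Path components of the difference graph\<close>

lemma component_edge_closed: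
  assumes C: "component C G" and G: "simple_graph G"
    and e: "e \<in> edges G" "x \<in> e" "x \<in> verts C"
  shows "e \<in> edges C"
proof -
  \<comment> \<open>Adding e and its ends to C preserves connectedness, so the maximality of C gives
    K = C.\<close>
  define K where "K = \<lparr>verts = verts C \<union> e, edges = insert e (edges C)\<rparr>"
  have sC: "subgraph C G" and cC: "connected_graph C"
    and mx: "\<And>K. subgraph K G \<Longrightarrow> connected_graph K \<Longrightarrow> subgraph C K \<Longrightarrow> K = C"
    using C by (auto simp: component_def)
  have ce: "card e = 2" "e \<subseteq> verts G" using G e by (auto simp: simple_graph_def)
  have fe: "finite e" using ce by (simp add: card_ge_0_finite)
  have sK: "subgraph K G"
    using sC ce fe e by (auto simp: subgraph_def simple_graph_def K_def)
  have CK: "subgraph C K" using sC by (auto simp: subgraph_def K_def)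
  have sub: "(adj_rel C)\<^sup>* \<subseteq> (adj_rel K)\<^sup>*"
    by (rule rtrancl_mono) (auto simp: adj_rel_def K_def)
  have sym: "sym ((adj_rel K)\<^sup>*)"
    by (rule sym_rtrancl) (auto simp: sym_def adj_rel_def insert_commute)
  have reach: "(u, x) \<in> (adj_rel K)\<^sup>*" if "u \<in> verts K" for u
  proof (cases "u \<in> verts C \<or> u = x")
    case True
    then show ?thesis using cC e(3) sub by (auto simp: connected_graph_def)
  next
    case False
    then have u: "u \<in> e" "u \<noteq> x" using that by (auto simp: K_def)
    then have "e = {u, x}" using ce(1) e(2) by (auto simp: card_2_iff)
    then show ?thesis using u by (intro r_into_rtrancl) (simp add: adj_rel_def K_def)
  qed
  have "connected_graph K"
    unfolding connected_graph_def
  proof (intro conjI ballI)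
    show "verts K \<noteq> {}" using e(2) by (auto simp: K_def)
    fix u v assume "u \<in> verts K" "v \<in> verts K"
    then show "(u, v) \<in> (adj_rel K)\<^sup>*"
      using reach sym by (meson rtrancl_trans symD)
  qed
  then have "K = C" using mx sK CK by blast
  then have "edges C = insert e (edges C)" by (metis K_def ugraph.select_convs(2))
  then show ?thesis by blast
qed

lemma path_graph_edge_first:
  assumes "distinct xs" "length xs = n + 1" "xs ! 0 \<in> {xs ! i, xs ! (i + 1)}" "i < n"
  shows "i = 0"
  using assms by (auto simp: nth_eq_iff_index_eq)

lemma path_graph_edge_last:
  assumes "distinct xs" "length xs = n + 1" "xs ! n \<in> {xs ! i, xs ! (i + 1)}" "i < n"
  shows "Suc i = n"
  using assms by (auto simp: nth_eq_iff_index_eq)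


text \<open>X and Y are left abstract because the classes of f and g exchange roles with the
  direction in which the path is read.\<close>

lemma alternating_edges:
  assumes "\<forall>i<n. a i \<in> (X - Y) \<union> (Y - X)"
    and "\<forall>i. Suc i < n \<longrightarrow> \<not> (a i \<in> X \<and> a (Suc i) \<in> X) \<and> \<not> (a i \<in> Y \<and> a (Suc i) \<in> Y)"
    and "a 0 \<in> X - Y" "i < n"
  shows "(even i \<longrightarrow> a i \<in> X - Y) \<and> (odd i \<longrightarrow> a i \<in> Y - X)"
  using assms(4)
proof (induction i)
  case 0 then show ?case using assms(3) by simp
next
  case (Suc i)
  then show ?case using assms(1,2) by (auto; blast)
qed

lemma color_class_unique:
  assumes "proper_coloring G t h" "e \<in> color_class G h j" "e' \<in> color_class G h j" "v \<in> e" "v \<in> e'"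
  shows "e = e'"
  using proper_coloring_unique[OF assms(1)] assms(2-) by (auto simp: color_class_def)

lemma edges_diff_graph:
  "edges (diff_graph G f g t) =
     (color_class G f t - color_class G g t) \<union> (color_class G g t - color_class G f t)"
  "verts (diff_graph G f g t) = \<Union> (edges (diff_graph G f g t))"
  by (simp_all add: diff_graph_def Let_def)

lemma simple_diff_graph:
  assumes "simple_graph G"
  shows "simple_graph (diff_graph G f g t)"
proof -
  have "edges (diff_graph G f g t) \<subseteq> edges G" by (auto simp: edges_diff_graph color_class_def)
  then have "verts (diff_graph G f g t) \<subseteq> verts G" 
    and "\<forall>e\<in>edges (diff_graph G f g t). card e = 2"
    using assms by (auto simp: edges_diff_graph(2) simple_graph_def)
  then show ?thesis using assms
    by (auto simp: simple_graph_def edges_diff_graph(2) intro: finite_subset)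
qed

lemma consecutive_path_edges:
  assumes "proper_coloring G t h" "distinct xs" "length xs = n + 1" "Suc i < n"
  shows "\<not> ({xs ! i, xs ! (i + 1)} \<in> color_class G h j \<and>
    {xs ! Suc i, xs ! (Suc i + 1)} \<in> color_class G h j)"
proof
  assume "{xs ! i, xs ! (i + 1)} \<in> color_class G h j \<and>
    {xs ! Suc i, xs ! (Suc i + 1)} \<in> color_class G h j"
  then have "{xs ! i, xs ! (i + 1)} = {xs ! Suc i, xs ! (Suc i + 1)}"
    using color_class_unique[OF assms(1), of _ j _ "xs ! Suc i"] by auto
  then have "xs ! i \<in> {xs ! Suc i, xs ! (Suc i + 1)}" by blast
  then show False using assms(2-4) by (auto simp: nth_eq_iff_index_eq)
qed

text \<open>Only the two ends need an argument. An edge violating \<open>first_free\<close> or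
  \<open>last_free\<close> would share that end with a path edge of the other class, so it would lie
  in one class only. It would then belong to the difference graph, hence to the component, and be
  that path edge itself, which has the wrong colour.\<close>

lemma path_component_even_alternating_path:
  assumes q: "q \<ge> 3" and A: "G \<in> class_A q" and t: "t \<ge> q + 2"
    and f: "proper_coloring G t f" and g: "proper_coloring G t g"
    and P: "component P (diff_graph G f g t)"
    and xs: "distinct xs" "length xs = n + 1" "verts P = set xs"
      "edges P = {{xs ! i, xs ! (i + 1)} | i. i < n}"
    and n: "even n" "n > 0"
    and start: "{xs ! 0, xs ! 1} \<in> color_class G g t"
  shows "even_alternating_path G q t (n div 2) f g xs"
proof -
  let ?X = "color_class G g t" and ?Y = "color_class G f t"
  define a where "a i = {xs ! i, xs ! (i + 1)}" for i
  have sG: "simple_graph (diff_graph G f g t)" using A simple_diff_graph by (auto simp: class_A_def)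
  have a_in: "a i \<in> (?X - ?Y) \<union> (?Y - ?X)" if "i < n" for i
  proof -
    have "a i \<in> edges P" using xs(4) that by (auto simp: a_def)
    then show ?thesis using P edges_diff_graph(1)[of G f g t]
      by (auto simp: component_def subgraph_def)
  qed
  have cons: "\<not> (a i \<in> ?X \<and> a (Suc i) \<in> ?X) \<and> \<not> (a i \<in> ?Y \<and> a (Suc i) \<in> ?Y)" if "Suc i < n" for i
    using consecutive_path_edges[OF f xs(1,2) that, of t] consecutive_path_edges[OF g xs(1,2) that, of t]
    by (simp add: a_def)
  have a0: "a 0 \<in> ?X - ?Y" using a_in[of 0] start n(2) by (auto simp: a_def)
  have alt: "(even i \<longrightarrow> a i \<in> ?X - ?Y) \<and> (odd i \<longrightarrow> a i \<in> ?Y - ?X)" if "i < n" for i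
    using alternating_edges[of n a ?X ?Y i] a_in cons a0 that by blast
  have closed: "\<exists>i<n. e = a i" if "e \<in> edges (diff_graph G f g t)" "j \<le> n" "xs ! j \<in> e" for e j
  proof -
    have "xs ! j \<in> verts P" using xs(2,3) that(2) by simp
    then show ?thesis using component_edge_closed[OF P sG that(1,3)] xs(4) by (auto simp: a_def)
  qed
  \<comment> \<open>As n is even, the last index n - 1 is odd.\<close>
  have last: "a (n - 1) \<in> ?Y - ?X" using alt[of "n - 1"] n by auto
  show ?thesis
  proof
    fix i assume "i < n div 2"
    then have i: "2 * i < n" "2 * i + 1 < n" by auto
    show "{xs ! (2 * i), xs ! (2 * i + 1)} \<in> ?X - ?Y"
      using alt[OF i(1)] by (simp add: a_def)
    show "{xs ! (2 * i + 1), xs ! (2 * i + 2)} \<in> ?Y - ?X"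
      using alt[OF i(2)] by (simp add: a_def)
  next
    fix e assume e: "e \<in> ?Y"
    show "xs ! 0 \<notin> e"
    proof
      assume v: "xs ! 0 \<in> e"
      have "e \<notin> ?X" using color_class_unique[OF g _ _ v, of t "a 0"] a0 e by (auto simp: a_def)
      then obtain i where "i < n" "e = a i" using closed[of e 0] e v by (auto simp: edges_diff_graph)
      then have "e = a 0" using path_graph_edge_first[OF xs(1,2)] v by (auto simp: a_def)
      then show False using a0 e by simp
    qed
  next
    fix e assume e: "e \<in> ?X"
    have "xs ! n \<notin> e"
    proof
      assume v: "xs ! n \<in> e"
      have "xs ! n \<in> a (n - 1)" using n(2) by (simp add: a_def)
      then have "e \<notin> ?Y" using color_class_unique[OF f _ _ v, of t "a (n - 1)"] last e by blast
      then obtain i where i: "i < n" "e = a i" using closed[of e n] e v by (auto simp: edges_diff_graph)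
      then have "Suc i = n" using path_graph_edge_last[OF xs(1,2)] v unfolding a_def by blast
      then have "e = a (n - 1)" using i by auto
      then show False using last e by simp
    qed
    then show "xs ! (2 * (n div 2)) \<notin> e" using n by simp
  qed (use q A t f g xs n in auto)
qed

section \<open>Choosing the direction of the path\<close>

theorem lemma3p1:
  fixes G :: "'a ugraph" and q t :: nat and f g :: "'a set \<Rightarrow> nat"
  assumes "q \<ge> 3"
    and "G \<in> class_A q"
    and "max_degree G = t" and "t \<ge> q + 2"
    and "proper_coloring G t f" and "proper_coloring G t g" and "f \<noteq> g"
    and "\<exists>P n. component P (diff_graph G f g t) \<and> path_graph_of_length P n \<and> even n"
  shows "\<exists>f'. proper_coloring G t f' \<and> n_equivalent G t (q + 1) f' f \<and>
    card (color_class G f' t \<inter> color_class G g t) > card (color_class G f t \<inter> color_class G g t)"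
proof -
  let ?X = "color_class G g t" and ?Y = "color_class G f t"
  obtain P n xs where P: "component P (diff_graph G f g t)" and n: "even n"
    and xs: "distinct xs" "length xs = n + 1" "verts P = set xs"
      "edges P = {{xs ! i, xs ! (i + 1)} | i. i < n}"
    using assms(8) unfolding path_graph_of_length_def by blast
  have sG: "simple_graph (diff_graph G f g t)" using assms(2) simple_diff_graph by (auto simp: class_A_def)
  have PG: "edges P \<subseteq> (?Y - ?X) \<union> (?X - ?Y)" "verts P \<subseteq> \<Union> (edges (diff_graph G f g t))"
    using P edges_diff_graph[of G f g t] by (auto simp: component_def subgraph_def)
  \<comment> \<open>Every vertex of the difference graph lies on one of its edges, so no component
    is a path of length 0.\<close>
  have "xs ! 0 \<in> verts P" using xs(2,3) by simp
  then obtain e where "e \<in> edges P"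
    using PG(2) component_edge_closed[OF P sG] by blast
  then have n0: "n > 0" using xs(4) by auto
  have main: ?thesis if "even_alternating_path G q t (n div 2) f g ys" for ys
    using even_alternating_path.conclusion[OF that] even_alternating_path.switched_gain[OF that]
    by metis
  show ?thesis
  proof (cases "{xs ! 0, xs ! 1} \<in> ?X")
    case True
    then show ?thesis
      using main path_component_even_alternating_path[OF assms(1,2,4-6) P xs n n0] by blast
  next
    case False
    \<comment> \<open>The first edge has colour t under f. Since the length is even, the last one
      has colour t under g, and the reversed path starts with it.\<close>
    define a where "a i = {xs ! i, xs ! (i + 1)}" for i
    have a_in: "a i \<in> (?Y - ?X) \<union> (?X - ?Y)" if "i < n" for i
      using PG(1) xs(4) that by (auto simp: a_def)
    have cons: "\<not> (a i \<in> ?Y \<and> a (Suc i) \<in> ?Y) \<and> \<not> (a i \<in> ?X \<and> a (Suc i) \<in> ?X)" if "Suc i < n" for i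
      using consecutive_path_edges[OF assms(5) xs(1,2) that, of t]
        consecutive_path_edges[OF assms(6) xs(1,2) that, of t]
      by (simp add: a_def)
    have "a 0 \<in> ?Y - ?X" using a_in[of 0] False n0 by (auto simp: a_def)
    then have "odd (n - 1) \<longrightarrow> a (n - 1) \<in> ?X - ?Y"
      using alternating_edges[of n a ?Y ?X "n - 1"] a_in cons n0 by simp
    then have last: "a (n - 1) \<in> ?X" using n n0 by simp
    have rev_edge: "{rev xs ! i, rev xs ! (i + 1)} = a (n - 1 - i)" if "i < n" for i
      using that xs(2) by (auto simp: rev_nth a_def Suc_diff_Suc)
    have "{{rev xs ! i, rev xs ! (i + 1)} | i. i < n} = (\<lambda>i. a (n - 1 - i)) ` {..<n}"
      using rev_edge by blast
    also have "\<dots> = a ` {..<n}"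
    proof (intro equalityI subsetI)
      fix e assume "e \<in> a ` {..<n}"
      then obtain i where "i < n" "e = a i" by auto
      then show "e \<in> (\<lambda>i. a (n - 1 - i)) ` {..<n}" by (intro image_eqI[of _ _ "n - 1 - i"]) auto
    qed auto
    also have "\<dots> = edges P" using xs(4) by (auto simp: a_def)
    finally have rev_edges: "edges P = {{rev xs ! i, rev xs ! (i + 1)} | i. i < n}" by simp
    have "{rev xs ! 0, rev xs ! 1} \<in> ?X" using rev_edge[of 0] n0 last by simp
    then show ?thesis
      using main path_component_even_alternating_path[OF assms(1,2,4-6) P _ _ _ rev_edges n n0] xs
      by simp
  qed
qed

end
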